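(* Let $m$ and $n$ be positive integers, and let $x_0\in\mathbb{R}$ satisfy $|x_0|\ge 2\cos\frac{\pi}{4m+2}$. Let $J(2m+1,2n)=\mathfrak{b}(4mn+2n-1,\,4mn-1)$ and $J(2m+1,-2n)=\mathfrak{b}(4mn+2n+1,\,4mn+1)$, with Riley polynomials $\Phi_{J(2m+1,2n)}(x,y)$ and $\Phi_{J(2m+1,-2n)}(x,y)$. Then (i) the equation $\Phi_{J(2m+1,2n)}(x_0,y)=0$ has at least $n-1$ real solutions $y$, and (ii) the equation $\Phi_{J(2m+1,-2n)}(x_0,y)=0$ has at least $n$ real solutions $y$.
   Context: Two-bridge knots: for relatively prime odd integers $p>q\ge 1$, $\mathfrak{b}(p,q)$ is the two-bridge knot whose double branched cover is the lens space $L(p,q)$. Its knot group has the Schubert presentation $\langle a,b\mid wa=bw\rangle$, where $a,b$ are meridians, $w=a^{\varepsilon_1}b^{\varepsilon_2}\cdots a^{\varepsilon_{p-2}}b^{\varepsilon_{p-1}}$ (letters alternate $a,b$) and $\varepsilon_j=(-1)^{\lfloor jq/p\rfloor}$. The double twist knots $J(2m+1,2n)$ and $J(2m+1,-2n)$ are the two-bridge knots $\mathfrak{b}(p,q)$ with the values of $p,q$ given in the claim. Riley polynomial: for $s\in\mathbb{C}\setminus\{0\}$ and $y\in\mathbb{C}$ put $$A=\begin{pmatrix} s & 1 \\ 0 & s^{-1} \end{pmatrix},\qquad B=\begin{pmatrix} s & 0 \\ 2-y & s^{-1} \end{pmatrix},$$ and let $W=(W_{ij})$ be the matrix obtained from the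 word $w$ by substituting $a\mapsto A$, $b\mapsto B$. The matrix equation $WA=BW$ is equivalent to the single equation $\widetilde\Phi_{\mathfrak{b}(p,q)}(s,y)=0$, where $\widetilde\Phi_{\mathfrak{b}(p,q)}(s,y)=W_{11}+(s^{-1}-s)W_{12}$ (in fact $WA-BW=\widetilde\Phi_{\mathfrak{b}(p,q)}(s,y)\begin{pmatrix} 0 & 1 \\ {y-2} & 0 \end{pmatrix}$). One has $\widetilde\Phi_{\mathfrak{b}(p,q)}(s,y)=\widetilde\Phi_{\mathfrak{b}(p,q)}(s^{-1},y)$, so it can be written as a polynomial in $x=s+s^{-1}$ and $y$ (with $x$ allowed to be any complex, in particular any real, number); this polynomial is the Riley polynomial $\Phi_{\mathfrak{b}(p,q)}(x,y)$. *)

theory Defs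
  imports "HOL-Analysis.Analysis" "HOL-Computational_Algebra.Polynomial"
begin

section \<open>Schubert's presentation of a two-bridge knot group\<close>

datatype generator = Gen_a | Gen_b

definition schubert_sign :: "nat \<Rightarrow> nat \<Rightarrow> nat \<Rightarrow> int" where
  "schubert_sign p q j = (-1) ^ (j * q div p)"

text \<open>A word is a list of pairs (generator, exponent); only the exponents \<open>1\<close> and \<open>-1\<close> occur.
  The word below is the \<open>w\<close> of the presentation \<open>\<langle>a, b | w a = b w\<rangle>\<close> of the group of
  \<open>b(p,q)\<close>.\<close>

definition schubert_word :: "nat \<Rightarrow> nat \<Rightarrow> (generator \<times> int) list" where
  "schubert_word p q =
     map (\<lambda>j. (if odd j then Gen_a else Gen_b, schubert_sign p q j)) [1..<p]"

section \<open>The Riley polynomial\<close>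

definition riley_A :: "complex \<Rightarrow> complex^2^2" where
  "riley_A s = vector [vector [s, 1], vector [0, inverse s]]"

definition riley_B :: "complex \<Rightarrow> complex \<Rightarrow> complex^2^2" where
  "riley_B s y = vector [vector [s, 0], vector [2 - y, inverse s]]"

fun letter_matrix :: "complex \<Rightarrow> complex \<Rightarrow> generator \<times> int \<Rightarrow> complex^2^2" where
  "letter_matrix s y (g, e) =
     (let M = (case g of Gen_a \<Rightarrow> riley_A s | Gen_b \<Rightarrow> riley_B s y)
      in if e = 1 then M else matrix_inv M)"

definition word_matrix ::
    "complex \<Rightarrow> complex \<Rightarrow> (generator \<times> int) list \<Rightarrow> complex^2^2" where
  "word_matrix s y w = foldr (\<lambda>l M. letter_matrix s y l ** M) w (mat 1)"

definition riley_fun :: "nat \<Rightarrow> nat \<Rightarrow> complex \<Rightarrow> complex \<Rightarrow> complex" where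
  "riley_fun p q s y =
     (let W = word_matrix s y (schubert_word p q)
      in W $ 1 $ 1 + (inverse s - s) * W $ 1 $ 2)"

text \<open>A bivariate polynomial is an element of \<open>\<complex>[x][y]\<close>: the inner variable is \<open>x\<close>, the outer
  one \<open>y\<close>.\<close>

definition poly2 :: "complex poly poly \<Rightarrow> complex \<Rightarrow> complex \<Rightarrow> complex" where
  "poly2 P x y = poly (poly P [:y:]) x"

text \<open>The definite description is justified by \<open>riley_poly_ex1\<close> below.\<close>

definition riley_poly :: "nat \<Rightarrow> nat \<Rightarrow> complex poly poly" where
  "riley_poly p q =
     (THE P. \<forall>s y. s \<noteq> 0 \<longrightarrow> poly2 P (s + inverse s) y = riley_fun p q s y)"

section \<open>Existence and uniqueness of the Riley polynomial\<close>

definition poly2_x :: "complex poly poly" where "poly2_x = [:[:0, 1:]:]"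

definition poly2_y :: "complex poly poly" where "poly2_y = [:0, 1:]"

lemma poly2_simps [simp]:
  "poly2 0 x y = 0" "poly2 1 x y = 1"
  "poly2 (P + Q) x y = poly2 P x y + poly2 Q x y"
  "poly2 (P - Q) x y = poly2 P x y - poly2 Q x y"
  "poly2 (- P) x y = - poly2 P x y"
  "poly2 (P * Q) x y = poly2 P x y * poly2 Q x y"
  "poly2 2 x y = 2" "poly2 poly2_x x y = x" "poly2 poly2_y x y = y"
  by (simp_all add: poly2_def poly2_x_def poly2_y_def)

lemma poly2_eqI:
  assumes "\<And>x y. poly2 P x y = poly2 Q x y"
  shows "P = Q"
proof (rule ccontr)
  assume "P \<noteq> Q"
  then have fin: "finite {c. poly (P - Q) c = 0}"
    by (intro poly_roots_finite) simp
  have "poly (P - Q) [:y:] = 0" for y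
    using assms by (simp add: poly2_def poly_eq_poly_eq_iff [symmetric] fun_eq_iff)
  then have "range (\<lambda>y::complex. [:y:]) \<subseteq> {c. poly (P - Q) c = 0}"
    by blast
  with fin have "finite (range (\<lambda>y::complex. [:y:]))"
    using finite_subset by blast
  then have "finite (UNIV :: complex set)"
    by (rule finite_imageD) (simp add: inj_on_def)
  then show False
    using infinite_UNIV_char_0 by blast
qed

lemma ex_add_inverse:
  fixes x :: complex
  obtains s where "s \<noteq> 0" "s + inverse s = x"
proof -
  define r where "r = csqrt (x^2 - 4)"
  define s where "s = (x + r) / 2"
  have r: "r^2 = x^2 - 4"
    by (simp add: r_def)
  have *: "s * (x - s) = 1"
    using r by (simp add: s_def field_simps power2_eq_square)
  then have "s \<noteq> 0"
    by auto
  moreover have "inverse s = x - s"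
    using * by (rule inverse_unique)
  ultimately show ?thesis
    using that by simp
qed

lemma matrix_2_eq_iff:
  fixes M N :: "complex^2^2"
  shows "M = N \<longleftrightarrow> M $ 1 $ 1 = N $ 1 $ 1 \<and> M $ 1 $ 2 = N $ 1 $ 2 \<and>
                  M $ 2 $ 1 = N $ 2 $ 1 \<and> M $ 2 $ 2 = N $ 2 $ 2"
  by (auto simp: vec_eq_iff forall_2)

lemma matrix_2_mult_nth [simp]:
  fixes M N :: "complex^2^2"
  shows "(M ** N) $ i $ j = M $ i $ 1 * N $ 1 $ j + M $ i $ 2 * N $ 2 $ j"
  by (simp add: matrix_matrix_mult_def sum_2)

lemma matrix_inv_eqI:
  fixes M N :: "complex^2^2"
  assumes "M ** N = mat 1" "N ** M = mat 1"
  shows "matrix_inv M = N"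
proof -
  have "\<exists>M'. M ** M' = mat 1 \<and> M' ** M = mat 1"
    using assms by blast
  then have "matrix_inv M ** M = mat 1"
    unfolding matrix_inv_def by (rule someI2_ex) simp
  then have "matrix_inv M ** M ** N = N"
    by simp
  then show ?thesis
    using assms(1) by (simp add: matrix_mul_assoc [symmetric])
qed

lemma riley_A_inv:
  assumes "s \<noteq> 0"
  shows "matrix_inv (riley_A s) = vector [vector [inverse s, -1], vector [0, s]]"
  by (rule matrix_inv_eqI) (use assms in \<open>auto simp: matrix_2_eq_iff riley_A_def mat_def\<close>)

lemma riley_B_inv:
  assumes "s \<noteq> 0"
  shows "matrix_inv (riley_B s y) = vector [vector [inverse s, 0], vector [y - 2, s]]"
  by (rule matrix_inv_eqI)
    (use assms in \<open>auto simp: matrix_2_eq_iff riley_B_def mat_def algebra_simps\<close>)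

lemma letter_matrix_eqs:
  assumes "s \<noteq> 0"
  shows "letter_matrix s y (Gen_a, 1) = vector [vector [s, 1], vector [0, inverse s]]"
    "letter_matrix s y (Gen_a, -1) = vector [vector [inverse s, -1], vector [0, s]]"
    "letter_matrix s y (Gen_b, 1) = vector [vector [s, 0], vector [2 - y, inverse s]]"
    "letter_matrix s y (Gen_b, -1) = vector [vector [inverse s, 0], vector [y - 2, s]]"
  using riley_A_inv [OF assms] riley_B_inv [OF assms]
  by (simp_all add: riley_A_def riley_B_def)

lemma word_matrix_append:
  "word_matrix s y (u @ v) = word_matrix s y u ** word_matrix s y v"
  by (induction u) (simp_all add: word_matrix_def matrix_mul_assoc)

text \<open>The matrix \<open>p\<^sub>0 I + p\<^sub>1 (A + B) + p\<^sub>2 A B\<close>. Matrices of this form whose coefficients are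
  polynomials in \<open>x = s + 1/s\<close> and \<open>y\<close> are closed under \<open>W \<mapsto> A\<^sup>e W B\<^sup>e\<close> and
  \<open>W \<mapsto> B\<^sup>e W A\<^sup>e\<close> for \<open>e = 1, -1\<close>.\<close>

definition sym_mat :: "complex \<Rightarrow> complex \<Rightarrow> complex \<Rightarrow> complex \<Rightarrow> complex \<Rightarrow> complex^2^2" where
  "sym_mat s y p0 p1 p2 = vector
     [vector [p0 + 2 * s * p1 + (s^2 + 2 - y) * p2, p1 + inverse s * p2],
      vector [(2 - y) * p1 + (2 - y) * inverse s * p2,
              p0 + 2 * inverse s * p1 + (inverse s)^2 * p2]]"

lemma sym_mat_steps:
  assumes s: "s \<noteq> 0" and x: "x = s + inverse s"
  shows
    "letter_matrix s y (Gen_a, 1) ** sym_mat s y p0 p1 p2 ** letter_matrix s y (Gen_b, 1) =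
       sym_mat s y p2 (- p1 - x * p2) (p0 + 2 * x * p1 + x * x * p2)"
    "letter_matrix s y (Gen_a, -1) ** sym_mat s y p0 p1 p2 ** letter_matrix s y (Gen_b, -1) =
       sym_mat s y (p2 + 2 * x * p1 + x * x * p0) (- p1 - x * p0) p0"
    "letter_matrix s y (Gen_b, 1) ** sym_mat s y p0 p1 p2 ** letter_matrix s y (Gen_a, 1) =
       sym_mat s y (- p2 - y * (p0 + 2 * x * p1 + (x * x - y) * p2))
         (x * (p0 + 2 * x * p1 + (x * x - y) * p2) - p1)
         (- (p0 + 2 * x * p1 + (x * x - y) * p2))"
    "letter_matrix s y (Gen_b, -1) ** sym_mat s y p0 p1 p2 ** letter_matrix s y (Gen_a, -1) =
       sym_mat s y (- p2 + 2 * x * x * p2 + 2 * x * p1 + (x * x - y) * (p0 - y * p2))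
         (- p1 - x * p2) (y * p2 - p0)"
  unfolding x letter_matrix_eqs [OF s] using s
  by (simp_all add: sym_mat_def matrix_2_eq_iff field_simps power2_eq_square)

definition sym_coeffs ::
    "(generator \<times> int) list \<Rightarrow> complex poly poly \<Rightarrow> complex poly poly \<Rightarrow>
     complex poly poly \<Rightarrow> bool" where
  "sym_coeffs w P0 P1 P2 \<longleftrightarrow> (\<forall>s x y. s \<noteq> 0 \<longrightarrow> x = s + inverse s \<longrightarrow>
     word_matrix s y w = sym_mat s y (poly2 P0 x y) (poly2 P1 x y) (poly2 P2 x y))"

lemma sym_mat_riley:
  assumes "s \<noteq> 0" "x = s + inverse s"
  shows "sym_mat s y p0 p1 p2 $ 1 $ 1 + (inverse s - s) * sym_mat s y p0 p1 p2 $ 1 $ 2 =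
    p0 + x * p1 + (x * x - 1 - y) * p2"
  using assms(1) unfolding assms(2) sym_mat_def by (simp add: field_simps power2_eq_square)

lemma sym_coeffs_Nil: "sym_coeffs [] 1 0 0"
  by (simp add: sym_coeffs_def sym_mat_def word_matrix_def matrix_2_eq_iff mat_def)

lemma word_matrix_Cons_snoc:
  "word_matrix s y (l # w @ [k]) =
     letter_matrix s y l ** word_matrix s y w ** letter_matrix s y k"
proof -
  have "word_matrix s y ([l] @ w @ [k]) =
      word_matrix s y [l] ** word_matrix s y w ** word_matrix s y [k]"
    by (simp add: word_matrix_append matrix_mul_assoc del: append_Cons)
  then show ?thesis
    by (simp add: word_matrix_def)
qed

lemma sym_coeffs_step:
  assumes "sym_coeffs w P0 P1 P2" and e: "e = 1 \<or> e = -1" and gh: "g \<noteq> h"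
  shows "\<exists>Q0 Q1 Q2. sym_coeffs ((g, e) # w @ [(h, e)]) Q0 Q1 Q2"
proof -
  let ?x = poly2_x and ?y = poly2_y
  note step = sym_coeffs_def word_matrix_Cons_snoc sym_mat_steps
  have gh': "g = Gen_a \<and> h = Gen_b \<or> g = Gen_b \<and> h = Gen_a"
    using gh by (cases g; cases h) auto
  have ab: "sym_coeffs ((Gen_a, 1) # w @ [(Gen_b, 1)])
      P2 (- P1 - ?x * P2) (P0 + 2 * ?x * P1 + ?x * ?x * P2)"
    using assms(1) by (simp add: step del: letter_matrix.simps)
  have ab': "sym_coeffs ((Gen_a, -1) # w @ [(Gen_b, -1)])
      (P2 + 2 * ?x * P1 + ?x * ?x * P0) (- P1 - ?x * P0) P0"
    using assms(1) by (simp add: step del: letter_matrix.simps)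
  have ba: "sym_coeffs ((Gen_b, 1) # w @ [(Gen_a, 1)])
      (- P2 - ?y * (P0 + 2 * ?x * P1 + (?x * ?x - ?y) * P2))
      (?x * (P0 + 2 * ?x * P1 + (?x * ?x - ?y) * P2) - P1)
      (- (P0 + 2 * ?x * P1 + (?x * ?x - ?y) * P2))"
    using assms(1) by (simp add: step del: letter_matrix.simps)
  have ba': "sym_coeffs ((Gen_b, -1) # w @ [(Gen_a, -1)])
      (- P2 + 2 * ?x * ?x * P2 + 2 * ?x * P1 + (?x * ?x - ?y) * (P0 - ?y * P2))
      (- P1 - ?x * P2) (?y * P2 - P0)"
    using assms(1) by (simp add: step del: letter_matrix.simps)
  show ?thesis
    using gh' e ab ab' ba ba' by blast
qed

lemma schubert_sign_sym:
  assumes "odd q" "coprime p q" "0 < j" "j < p"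
  shows "schubert_sign p q (p - j) = schubert_sign p q j"
proof -
  have p: "p > 0"
    using assms by simp
  have "\<not> p dvd j * q"
    using assms by (metis coprime_dvd_mult_left_iff nat_dvd_not_less)
  then have r: "0 < j * q mod p" "j * q mod p < p"
    using p by (simp_all add: mod_greater_zero_iff_not_dvd)
  define k where "k = j * q div p"
  have jq: "j * q = k * p + j * q mod p"
    by (simp add: k_def)
  have "k < q"
  proof -
    have "k * p < q * p"
      using jq assms r by (metis add_lessD1 le_eq_less_or_eq mult.commute mult_less_cancel1
          odd_pos)
    then show ?thesis
      by simp
  qed
  have "(q - 1 - k) * p + p + k * p = q * p"
  proof -
    have "(q - 1 - k) + 1 + k = q"
      using \<open>k < q\<close> by simp
    then show ?thesis
      by (metis add_mult_distrib mult_1)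
  qed
  then have "(p - j) * q = (q - 1 - k) * p + (p - j * q mod p)"
    using jq r unfolding diff_mult_distrib [of p] by (simp add: mult.commute [of p q])
  then have "(p - j) * q div p = q - 1 - k"
    using r by (intro div_nat_eqI) (simp_all add: algebra_simps)
  moreover have "even (q - 1 - k) = even k"
    using \<open>odd q\<close> \<open>k < q\<close> by (auto elim!: oddE)
  ultimately show ?thesis
    by (simp add: schubert_sign_def k_def [symmetric] minus_one_power_iff)
qed

lemma sym_coeffs_schubert_word:
  assumes "odd p" "odd q" "coprime p q"
  shows "\<exists>P0 P1 P2. sym_coeffs (schubert_word p q) P0 P1 P2"
proof -
  obtain h where h: "p = 2 * h + 1"
    using \<open>odd p\<close> by (rule oddE)
  define f where
    "f = (\<lambda>j. (if odd j then Gen_a else Gen_b, schubert_sign p q j))"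
  have "\<exists>P0 P1 P2. sym_coeffs (map f [h + 1 - d..<h + 1 + d]) P0 P1 P2" if "d \<le> h" for d
    using that
  proof (induction d)
    case 0
    then show ?case
      using sym_coeffs_Nil by auto
  next
    case (Suc d)
    then obtain P0 P1 P2 where
      IH: "sym_coeffs (map f [h + 1 - d..<h + 1 + d]) P0 P1 P2"
      by auto
    define e where "e = schubert_sign p q (h - d)"
    have pj: "p - (h - d) = h + 1 + d"
      using Suc.prems h by simp
    have e': "schubert_sign p q (h + 1 + d) = e"
      using schubert_sign_sym [OF assms(2,3), of "h - d"] Suc.prems h
      unfolding pj e_def by simp
    have "h + 1 - Suc d = h - d" "Suc (h - d) = h + 1 - d"
      using Suc.prems by auto
    then have "[h + 1 - Suc d..<h + 1 + Suc d] =
        (h - d) # [h + 1 - d..<h + 1 + d] @ [h + 1 + d]"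
      using Suc.prems by (simp add: upt_conv_Cons Suc_diff_le) arith
    moreover have "f (h - d) = (if odd (h - d) then Gen_a else Gen_b, e)"
      by (simp add: f_def e_def)
    moreover have "f (h + 1 + d) = (if odd (h - d) then Gen_b else Gen_a, e)"
      using e' Suc.prems by (auto simp: f_def)
    moreover have "e = 1 \<or> e = -1"
      by (auto simp: e_def schubert_sign_def minus_one_power_iff)
    ultimately show ?case
      using sym_coeffs_step [OF IH, of e "fst (f (h - d))" "fst (f (h + 1 + d))"]
      by auto
  qed
  from this [of h] show ?thesis
    by (simp add: schubert_word_def f_def h mult_2)
qed

lemma riley_poly_ex1:
  assumes "odd p" "odd q" "coprime p q"
  shows "\<exists>!P. \<forall>s y. s \<noteq> 0 \<longrightarrow> poly2 P (s + inverse s) y = riley_fun p q s y"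
proof -
  obtain P0 P1 P2 where P: "sym_coeffs (schubert_word p q) P0 P1 P2"
    using sym_coeffs_schubert_word [OF assms] by blast
  let ?x = poly2_x and ?y = poly2_y
  let ?P = "P0 + ?x * P1 + (?x * ?x - 1 - ?y) * P2"
  have ex: "\<forall>s y. s \<noteq> 0 \<longrightarrow> poly2 ?P (s + inverse s) y = riley_fun p q s y"
    using P by (simp add: sym_coeffs_def riley_fun_def sym_mat_riley)
  show ?thesis
  proof (rule ex1I [of _ ?P])
    fix Q :: "complex poly poly"
    assume Q: "\<forall>s y. s \<noteq> 0 \<longrightarrow> poly2 Q (s + inverse s) y = riley_fun p q s y"
    show "Q = ?P"
    proof (rule poly2_eqI)
      fix x y :: complex
      obtain s where "s \<noteq> 0" "s + inverse s = x"
        using ex_add_inverse by blast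
      then show "poly2 Q x y = poly2 ?P x y"
        using ex Q by metis
    qed
  qed (rule ex)
qed

text \<open>In particular \<open>WA = BW\<close> if and only if \<open>riley_fun\<close> vanishes.\<close>

lemma riley_matrix_equation:
  fixes s y :: complex
  assumes "odd p" "odd q" "coprime p q" "s \<noteq> 0"
  defines "W \<equiv> word_matrix s y (schubert_word p q)"
  shows "W ** riley_A s - riley_B s y ** W =
    vector [vector [0, riley_fun p q s y], vector [riley_fun p q s y * (y - 2), 0]]"
proof -
  obtain P0 P1 P2 where "sym_coeffs (schubert_word p q) P0 P1 P2"
    using sym_coeffs_schubert_word [OF assms(1-3)] by blast
  then obtain p0 p1 p2 where W: "W = sym_mat s y p0 p1 p2"
    using assms(4) by (auto simp: sym_coeffs_def W_def)
  have R: "riley_fun p q s y = W $ 1 $ 1 + (inverse s - s) * W $ 1 $ 2"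
    by (simp only: riley_fun_def W_def Let_def)
  show ?thesis
    using assms(4) unfolding R W
    by (simp add: sym_mat_def matrix_2_eq_iff riley_A_def riley_B_def field_simps
        power2_eq_square)
qed

lemma poly2_riley_poly:
  assumes "odd p" "odd q" "coprime p q" "s \<noteq> 0"
  shows "poly2 (riley_poly p q) (s + inverse s) y = riley_fun p q s y"
  using theI' [OF riley_poly_ex1 [OF assms(1-3)]] assms(4) unfolding riley_poly_def by blast

end

theory Submission
  imports Defs
begin

text \<open>Up to the outer letters, the Schubert words of \<open>J(2m+1, -2n)\<close> and \<open>J(2m+1, 2n)\<close> are the
  \<open>n\<close>-th powers of \<open>v = (ab\<^sup>-\<^sup>1)\<^sup>m a (ba\<^sup>-\<^sup>1)\<^sup>m b\<close> and of its inverse. By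
  Cayley--Hamilton both Riley polynomials are therefore combinations of Chebyshev polynomials in the
  trace \<open>z\<close> of \<open>v\<close>, whose coefficients involve the Riley polynomial \<open>R\<close> of \<open>v\<close>. On the interval
  \<open>[x\<^sub>0\<^sup>2 - 2, x\<^sub>0\<^sup>2 + 2]\<close> the trace goes from \<open>2\<close> to a value \<open>\<le> -2\<close>. At points where
  \<open>z = 2 cos (j\<pi>/n)\<close>, \<open>0 \<le> j < n\<close>, both polynomials equal \<open>(-1)\<^sup>j\<close>. The bound on \<open>x\<^sub>0\<close> gives
  \<open>R \<le> -1\<close> where \<open>z = -2\<close>, hence one further sign change for \<open>J(2m+1, -2n)\<close>.\<close>

section \<open>Chebyshev polynomials\<close>

text \<open>Indexed so that \<open>cheb t k\<close> is the Chebyshev polynomial \<open>S\<^sub>k\<^sub>-\<^sub>1(t)\<close> of the knot theory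
  literature.\<close>

fun cheb :: "'a::comm_ring_1 \<Rightarrow> nat \<Rightarrow> 'a" where
  "cheb t 0 = 0"
| "cheb t (Suc 0) = 1"
| "cheb t (Suc (Suc k)) = t * cheb t (Suc k) - cheb t k"

lemma cheb_of_real: "cheb (of_real t :: complex) k = of_real (cheb t k)"
  by (induction t k rule: cheb.induct) simp_all

text \<open>The step \<open>(p, q)\<close> to \<open>(t * p - q, p)\<close> of the recurrence
  preserves the quadratic form \<open>p^2 - t * p * q + q^2\<close>.\<close>

lemma cheb_quadratic:
  "cheb t (Suc k) ^ 2 - t * cheb t (Suc k) * cheb t k + cheb t k ^ 2 = 1"
proof (induction k)
  case (Suc k)
  then show ?case
    by (simp add: power2_eq_square algebra_simps)
qed simp

lemma cheb_cos: "cheb (2 * cos \<theta>) k * sin \<theta> = sin (real k * \<theta>)"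
proof (induction "2 * cos \<theta>" k rule: cheb.induct)
  case (3 k)
  have "sin (real (Suc (Suc k)) * \<theta>) + sin (real k * \<theta>) = 2 * cos \<theta> * sin (real (Suc k) * \<theta>)"
    using sin_plus_sin [of "real (Suc (Suc k)) * \<theta>" "real k * \<theta>"]
    by (simp add: algebra_simps add_divide_distrib)
  with 3 show ?case
    by (simp add: left_diff_distrib mult.assoc)
qed simp_all

lemma cheb_2: "cheb 2 k = of_nat k"
  by (induction "2::'a" k rule: cheb.induct) simp_all

lemma cheb_minus_2: "cheb (-2) k = - ((-1) ^ k * of_nat k)"
  by (induction "-2::'a" k rule: cheb.induct) (simp_all add: algebra_simps)

text \<open>With \<theta> = j pi / n the values are sin (n \<theta>) / sin \<theta> and sin ((n + 1)
  \<theta>) / sin \<theta>. At j = 0 the denominator vanishes and \<open>cheb 2 n\<close> is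
  \<open>n\<close>, not 0.\<close>

lemma cheb_at_root:
  assumes "0 < j" "j < n"
  shows "cheb (2 * cos (real j * pi / real n)) n = 0"
    and "cheb (2 * cos (real j * pi / real n)) (Suc n) = (-1) ^ j"
proof -
  define \<theta> where "\<theta> = real j * pi / real n"
  have "0 < \<theta>" "\<theta> < pi"
    using assms by (auto simp: \<theta>_def field_simps)
  then have s: "sin \<theta> > 0"
    by (rule sin_gt_zero)
  have n: "real n * \<theta> = real j * pi"
    using assms by (simp add: \<theta>_def)
  have "cheb (2 * cos \<theta>) n * sin \<theta> = 0"
    unfolding cheb_cos n by simp
  with s show "cheb (2 * cos (real j * pi / real n)) n = 0"
    by (simp add: \<theta>_def)
  have "real (Suc n) * \<theta> = \<theta> + real j * pi"
    using n by (simp add: algebra_simps)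
  then have "cheb (2 * cos \<theta>) (Suc n) * sin \<theta> = (-1) ^ j * sin \<theta>"
    unfolding cheb_cos by (simp add: sin_add)
  with s show "cheb (2 * cos (real j * pi / real n)) (Suc n) = (-1) ^ j"
    by (simp add: \<theta>_def)
qed

text \<open>The increments of the sequence do not decrease: each exceeds its predecessor by
  \<open>(t - 2) * cheb t (Suc k)\<close>.\<close>

lemma cheb_increment_ge_1:
  fixes t :: real
  assumes "t \<ge> 2"
  shows "cheb t k \<ge> 0 \<and> cheb t (Suc k) - cheb t k \<ge> 1"
proof (induction k)
  case (Suc k)
  then have "2 * cheb t (Suc k) \<le> t * cheb t (Suc k)"
    using assms by (intro mult_right_mono) auto
  with Suc show ?case
    by (simp only: cheb.simps) linarith
qed simp

text \<open>For y = 2 cos \<theta> below 2, the difference of the squares times sin^2 \<theta> is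
  sin ((2m + 1) \<theta>) sin \<theta>, and the bound on \<open>y\<close> says (2m + 1) \<theta>
  \<le> pi.\<close>

lemma cheb_square_mono:
  fixes y :: real
  assumes "m > 0" and y: "y \<ge> 2 * cos (pi / (2 * real m + 1))"
  shows "cheb y m ^ 2 \<le> cheb y (Suc m) ^ 2"
proof (cases "y \<ge> 2")
  case True
  show ?thesis
    using cheb_increment_ge_1 [OF True, of m] by (intro power_mono) auto
next
  case False
  define \<alpha> where "\<alpha> = pi / (2 * real m + 1)"
  define \<theta> where "\<theta> = arccos (y / 2)"
  have \<alpha>: "0 \<le> \<alpha>" "\<alpha> \<le> pi"
    by (auto simp: \<alpha>_def field_simps)
  have "cos \<alpha> \<ge> -1" by simp
  then have y': "-1 \<le> y / 2" "y / 2 < 1"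
    using y False by (auto simp: \<alpha>_def simp del: cos_ge_minus_one)
  have c: "y = 2 * cos \<theta>"
    using y' by (simp add: \<theta>_def)
  have "\<theta> \<noteq> 0"
    using c y' by auto
  then have \<theta>: "0 < \<theta>" "\<theta> \<le> pi"
    using arccos_bounded [of "y/2"] y' by (auto simp: \<theta>_def)
  have "\<theta> \<le> \<alpha>"
  proof -
    have "cos \<alpha> \<le> cos \<theta>"
      using y c by (simp add: \<alpha>_def)
    then show ?thesis
      using \<alpha> \<theta> by (simp add: cos_mono_le_eq)
  qed
  then have le: "(2 * real m + 1) * \<theta> \<le> pi"
    by (simp add: \<alpha>_def field_simps)
  \<comment> \<open>Positivity of \<open>m\<close> excludes \<theta> = pi, so sin \<theta> can be
    cancelled at the end.\<close>
  have "real m * \<theta> > 0"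
    using \<open>m > 0\<close> \<theta> by simp
  then have "\<theta> < pi"
    using le \<theta> by (simp add: algebra_simps)
  then have s: "sin \<theta> > 0"
    using \<theta> by (intro sin_gt_zero)
  have s': "sin ((2 * real m + 1) * \<theta>) \<ge> 0"
    using le \<theta> by (intro sin_ge_zero) auto
  have "(cheb y (Suc m) ^ 2 - cheb y m ^ 2) * sin \<theta> ^ 2 =
      sin (real (Suc m) * \<theta>) ^ 2 - sin (real m * \<theta>) ^ 2"
    unfolding c by (simp only: cheb_cos [symmetric] left_diff_distrib power_mult_distrib)
  also have "\<dots> = sin ((2 * real m + 1) * \<theta>) * sin \<theta>"
  proof -
    have "sin (u + v) * sin (u - v) = sin u ^ 2 - sin v ^ 2" for u v :: real
      using sin_cos_squared_add [of u] sin_cos_squared_add [of v]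
      unfolding sin_add sin_diff by algebra
    from this [of "real (Suc m) * \<theta>" "real m * \<theta>"] show ?thesis
      by (simp add: algebra_simps)
  qed
  finally have "(cheb y (Suc m) ^ 2 - cheb y m ^ 2) * sin \<theta> ^ 2 \<ge> 0"
    using s s' by simp
  then show ?thesis
    using s by (simp add: zero_le_mult_iff)
qed

section \<open>The matrix of a Schubert word\<close>

lemma det_letter_matrix: "s \<noteq> 0 \<Longrightarrow> det (letter_matrix s y l) = 1"
  using riley_A_inv [of s] riley_B_inv [of s y]
  by (cases l; cases "fst l") (auto simp: det_2 riley_A_def riley_B_def Let_def)

lemma det_word_matrix: "s \<noteq> 0 \<Longrightarrow> det (word_matrix s y w) = 1"
  by (induction w) (simp_all add: word_matrix_def det_mul det_letter_matrix)

text \<open>By Cayley--Hamilton. The coefficient of the identity equals \<open>- cheb t (n - 1)\<close> for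
  \<open>n > 0\<close>.\<close>

lemma word_matrix_power:
  fixes s y :: complex and w :: "(generator \<times> int) list"
  assumes "s \<noteq> 0"
  defines "M \<equiv> word_matrix s y w"
  defines "t \<equiv> M $ 1 $ 1 + M $ 2 $ 2"
  shows "word_matrix s y (concat (replicate n w)) =
    (\<chi> i j. (cheb t (Suc n) - t * cheb t n) * (mat 1 :: complex^2^2) $ i $ j + cheb t n * M $ i $ j)"
proof (induction n)
  case 0
  then show ?case by (simp add: word_matrix_def matrix_2_eq_iff)
next
  case (Suc n)
  have "M $ 1 $ 1 * M $ 2 $ 2 - M $ 1 $ 2 * M $ 2 $ 1 = 1"
    using det_word_matrix [OF assms(1), of y w] by (simp add: M_def det_2)
  then show ?case
    unfolding replicate_Suc concat.simps word_matrix_append Suc M_def [symmetric]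
    by (simp add: matrix_2_eq_iff mat_def t_def) algebra
qed

section \<open>Periodic words of alternating signs\<close>

definition block_letter ::
    "nat \<Rightarrow> generator \<Rightarrow> generator \<Rightarrow> int \<Rightarrow> nat \<Rightarrow> generator \<times> int" where
  "block_letter m g h e i = (if even i then g else h, e * (-1) ^ (i + i div (2 * m + 1)))"

text \<open>The instance \<open>Gen_a Gen_b 1\<close> is the word v, and
  \<open>Gen_b Gen_a (-1)\<close> is its inverse letter by letter. In \<open>block_letter\<close>,
  positions count from 0, and the quotient by \<open>2 * m + 1\<close> repeats a sign at each
  junction of two half blocks.\<close>

definition block_word :: "nat \<Rightarrow> generator \<Rightarrow> generator \<Rightarrow> int \<Rightarrow> (generator \<times> int) list" where
  "block_word m g h e =
     concat (replicate m [(g, e), (h, - e)]) @ [(g, e)] @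
     concat (replicate m [(h, e), (g, - e)]) @ [(h, e)]"

lemma concat_replicate_Suc: "concat (replicate (Suc n) w) = concat (replicate n w) @ w"
  by (simp flip: replicate_append_same)

lemma map_alternating:
  "map (\<lambda>i. (if even i then g else h, e * (-1) ^ i)) [0..<2 * k] =
     concat (replicate k [(g, e), (h, - e :: int)])"
  by (induction k) (simp_all add: concat_replicate_Suc del: replicate_Suc)

text \<open>A shift by the odd number \<open>2 * m + 1\<close> exchanges the generators; its effect
  on the sign is cancelled by the quotient growing by 1.\<close>

lemma map_block_letter_period:
  "map (block_letter m g h e) [0..<4 * m + 2] = block_word m g h e"
proof -
  have 1: "map (block_letter m g h e) [0..<2 * m + 1] =
      map (\<lambda>i. (if even i then g else h, e * (-1) ^ i)) [0..<2 * m] @ [(g, e)]"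
    by (simp add: block_letter_def)
  have "[2 * m + 1..<4 * m + 2] = map (\<lambda>i. i + (2 * m + 1)) [0..<2 * m + 1]"
    by (simp only: map_add_upt) (simp del: upt_Suc)
  then have "map (block_letter m g h e) [2 * m + 1..<4 * m + 2] =
      map (\<lambda>i. block_letter m g h e (i + (2 * m + 1))) [0..<2 * m + 1]"
    by (simp only: map_map o_def)
  also have "\<dots> = map (\<lambda>i. (if even i then h else g, e * (-1) ^ i)) [0..<2 * m + 1]"
  proof (intro map_cong refl)
    fix i
    assume "i \<in> set [0..<2 * m + 1]"
    then have "(i + (2 * m + 1)) div (2 * m + 1) = 1"
      by (intro div_nat_eqI) auto
    then show "block_letter m g h e (i + (2 * m + 1)) = (if even i then h else g, e * (-1) ^ i)"
      by (simp only: block_letter_def) (simp add: minus_one_power_iff)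
  qed
  also have "\<dots> = map (\<lambda>i. (if even i then h else g, e * (-1) ^ i)) [0..<2 * m] @ [(h, e)]"
    by simp
  finally have 2: "map (block_letter m g h e) [2 * m + 1..<4 * m + 2] = \<dots>" .
  have "[0..<4 * m + 2] = [0..<2 * m + 1] @ [2 * m + 1..<4 * m + 2]"
    using upt_add_eq_append [of 0 "2 * m + 1" "2 * m + 1"] by simp
  then show ?thesis
    by (simp only: map_append 1 2 map_alternating block_word_def append_assoc)
qed

lemma block_letter_periodic: "block_letter m g h e (i + (4 * m + 2) * n) = block_letter m g h e i"
proof -
  have "(i + (4 * m + 2) * n) div (2 * m + 1) = i div (2 * m + 1) + 2 * n"
    using div_mult_self1 [of "2 * m + 1" i "2 * n"] by (simp add: algebra_simps)
  then show ?thesis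
    by (simp add: block_letter_def minus_one_power_iff)
qed

lemma map_block_letter:
  "map (block_letter m g h e) [0..<(4 * m + 2) * n] = concat (replicate n (block_word m g h e))"
proof (induction n)
  case (Suc n)
  have "[(4 * m + 2) * n..<(4 * m + 2) * Suc n] =
      map (\<lambda>i. i + (4 * m + 2) * n) [0..<4 * m + 2]"
    by (simp only: map_add_upt) (simp del: upt_Suc)
  then have "map (block_letter m g h e) [(4 * m + 2) * n..<(4 * m + 2) * Suc n] =
      block_word m g h e"
    by (simp only: map_map o_def block_letter_periodic map_block_letter_period)
  moreover have "[0..<(4 * m + 2) * Suc n] =
      [0..<(4 * m + 2) * n] @ [(4 * m + 2) * n..<(4 * m + 2) * Suc n]"
    using upt_add_eq_append [of 0 "(4 * m + 2) * n" "4 * m + 2"] by (simp add: add.commute)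
  ultimately show ?case
    by (simp only: map_append Suc concat_replicate_Suc)
qed simp

text \<open>From j q / p = j - j d / p with j d / p strictly between k and k + 1, the floor is j - k
  - 1. For both families d = 2n, which is easier to divide than j q.\<close>

lemma schubert_sign_eq:
  assumes "p = q + d" "k * p < j * d" "j * d < Suc k * p"
  shows "schubert_sign p q j = (-1) ^ (Suc (j + k))"
proof -
  have "k * p < j * p"
    using assms by (metis le_add2 le_trans less_le_not_le mult_le_mono2 nat_le_linear)
  then have kj: "k < j" by simp
  then obtain i where j: "j = Suc (k + i)"
    using less_iff_Suc_add by auto
  have "j * q div p = i"
    using assms unfolding j by (intro div_nat_eqI) (simp_all add: algebra_simps)
  then show ?thesis
    by (simp add: schubert_sign_def j minus_one_power_iff)
qed

lemma schubert_word_minus: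
  "schubert_word (4 * m * n + 2 * n + 1) (4 * m * n + 1) =
     concat (replicate n (block_word m Gen_a Gen_b 1))"
proof -
  let ?p = "4 * m * n + 2 * n + 1" and ?q = "4 * m * n + 1"
  have sgn: "schubert_sign ?p ?q (Suc i) = (-1) ^ (i + i div (2 * m + 1))"
    if i: "i < (4 * m + 2) * n" for i
  proof -
    define k where "k = i div (2 * m + 1)"
    define r where "r = i mod (2 * m + 1)"
    have ikr: "i = k * (2 * m + 1) + r"
      unfolding k_def r_def by (rule div_mult_mod_eq [symmetric])
    have r: "r \<le> 2 * m"
      using mod_less_divisor [of "2 * m + 1" i] by (simp add: r_def)
    have k: "k < 2 * n"
      using i unfolding k_def by (intro less_mult_imp_div_less) (simp add: algebra_simps)
    \<comment> \<open>Since p = 2n (2m + 1) + 1, dividing 2n (i + 1) by p gives quotient k and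
      remainder 2n (r + 1) - k; the equation is additive to avoid truncated subtraction.\<close>
    have e: "Suc i * (2 * n) + k = k * ?p + 2 * n * Suc r"
      unfolding ikr by (simp add: algebra_simps)
    have "2 * n * Suc r \<le> 2 * n * (2 * m + 1)"
      using r by (intro mult_left_mono) auto
    also have "\<dots> < ?p"
      by (simp add: algebra_simps)
    finally have "2 * n * Suc r < ?p" .
    moreover have "k < 2 * n * Suc r"
      using k by simp
    ultimately have "k * ?p < Suc i * (2 * n)" "Suc i * (2 * n) < Suc k * ?p"
      using e by (simp_all only: mult_Suc)
    then have "schubert_sign ?p ?q (Suc i) = (-1) ^ (Suc (Suc i + k))"
      by (intro schubert_sign_eq [of _ _ "2 * n"]) auto
    then show ?thesis
      by (simp add: k_def)
  qed
  have upt: "[1..<?p] = map Suc [0..<(4 * m + 2) * n]"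
    by (simp add: map_Suc_upt algebra_simps)
  have "schubert_word ?p ?q = map (block_letter m Gen_a Gen_b 1) [0..<(4 * m + 2) * n]"
    unfolding schubert_word_def upt map_map
  proof (intro map_cong refl)
    fix i
    assume "i \<in> set [0..<(4 * m + 2) * n]"
    then have "i < (4 * m + 2) * n"
      by (simp only: set_upt atLeastLessThan_iff)
    from sgn [OF this] show "((\<lambda>j. (if odd j then Gen_a else Gen_b, schubert_sign ?p ?q j)) \<circ> Suc) i =
        block_letter m Gen_a Gen_b 1 i"
      by (simp only: o_def block_letter_def) simp
  qed
  then show ?thesis
    by (simp only: map_block_letter)
qed

text \<open>Here p + 1 = (4m + 2) n, so the Schubert word is two letters short of n full blocks. The
  added first letter takes position 0, so Schubert's index j is also the position in the block
  word.\<close>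

lemma schubert_word_plus:
  assumes "m > 0" "n > 0"
  shows "(Gen_b, -1) # schubert_word (4 * m * n + 2 * n - 1) (4 * m * n - 1) @ [(Gen_a, -1)] =
     concat (replicate n (block_word m Gen_b Gen_a (-1)))"
proof -
  define p where "p = 4 * m * n + 2 * n - 1"
  define q where "q = 4 * m * n - 1"
  have mn: "m * n > 0"
    using assms by simp
  have p: "Suc p = (4 * m + 2) * n"
    using assms mn unfolding p_def by (simp add: algebra_simps)
  have pq: "p = q + 2 * n"
    using mn by (simp add: p_def q_def)
  have sgn: "schubert_sign p q i = - ((-1) ^ (i + i div (2 * m + 1)))"
    if i: "i < p" "i > 0" for i
  proof -
    define k where "k = i div (2 * m + 1)"
    define r where "r = i mod (2 * m + 1)"
    have ikr: "i = k * (2 * m + 1) + r"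
      unfolding k_def r_def by (rule div_mult_mod_eq [symmetric])
    have r: "r \<le> 2 * m"
      using mod_less_divisor [of "2 * m + 1" i] by (simp add: r_def)
    have k: "k < 2 * n"
      using i p unfolding k_def by (intro less_mult_imp_div_less) (simp add: algebra_simps)
    have p': "Suc p = (2 * m + 1) * (2 * n)"
      using p by (simp add: algebra_simps)
    have e: "i * (2 * n) = k * p + (k + 2 * n * r)"
    proof -
      have "i * (2 * n) = k * ((2 * m + 1) * (2 * n)) + 2 * n * r"
        unfolding ikr by (simp only: algebra_simps)
      then show ?thesis
        unfolding p' [symmetric] by simp
    qed
    \<comment> \<open>The remainder reaches p only for k = 2n - 1 and r = 2m, that is, at i = p, the
      position of the added last letter.\<close>
    have "k + 2 * n * r < p"
    proof (rule ccontr)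
      assume c: "\<not> ?thesis"
      have "2 * n * r \<le> 2 * n * (2 * m)"
        using r by (intro mult_left_mono) auto
      moreover have "Suc p = 2 * n * (2 * m) + 2 * n"
        using p' by (simp add: algebra_simps)
      ultimately have "Suc k = 2 * n" "2 * n * r = 2 * n * (2 * m)"
        using c k by linarith+
      then have k': "Suc k = 2 * n" and r': "r = 2 * m"
        using assms by simp_all
      have "Suc i = Suc k * (2 * m + 1)"
        unfolding ikr r' by simp
      then have "Suc i = Suc p"
        unfolding k' p' by (simp only: mult.commute)
      then show False
        using i by simp
    qed
    moreover have "0 < k + 2 * n * r"
      using i assms ikr by (cases k; cases r) auto
    ultimately have "k * p < i * (2 * n)" "i * (2 * n) < Suc k * p"
      using e by (simp_all only: mult_Suc)
    then have "schubert_sign p q i = (-1) ^ (Suc (i + k))"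
      by (intro schubert_sign_eq [OF pq])
    then show ?thesis
      by (simp add: k_def)
  qed
  have p0: "p > 0" "odd p"
    using mn assms by (auto simp: p_def)
  have "p = 2 * m + (2 * n - 1) * (2 * m + 1)"
  proof -
    have "Suc p = Suc (2 * m + (2 * n - 1) * (2 * m + 1))"
      using p assms by (cases n) (simp_all add: algebra_simps)
    then show ?thesis by simp
  qed
  then have "p div (2 * m + 1) = (2 * n - 1) + 2 * m div (2 * m + 1)"
    by (simp only: div_mult_self1)
  then have "p div (2 * m + 1) = 2 * n - 1"
    by simp
  then have last: "block_letter m Gen_b Gen_a (-1) p = (Gen_a, -1)"
    using p0 assms by (simp add: block_letter_def)
  have first: "block_letter m Gen_b Gen_a (-1) 0 = (Gen_b, -1)"
    by (simp add: block_letter_def)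
  have "[0..<(4 * m + 2) * n] = 0 # [1..<p] @ [p]"
    unfolding p [symmetric] using p0 by (simp add: upt_conv_Cons)
  moreover have "map (block_letter m Gen_b Gen_a (-1)) [1..<p] = schubert_word p q"
    by (auto simp: schubert_word_def sgn block_letter_def)
  ultimately have "map (block_letter m Gen_b Gen_a (-1)) [0..<(4 * m + 2) * n] =
      (Gen_b, -1) # schubert_word p q @ [(Gen_a, -1)]"
    by (simp only: list.map map_append first last)
  then show ?thesis
    by (simp only: map_block_letter p_def q_def)
qed

section \<open>Closed forms of the Riley polynomials\<close>

text \<open>The trace of v, shared by its inverse. The ring is left general because the matrices
  live over the complex numbers and the root count over the reals.\<close>

definition block_trace :: "nat \<Rightarrow> 'a::comm_ring_1 \<Rightarrow> 'a \<Rightarrow> 'a" where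
  "block_trace m x y = 2 + (x^2 - 2 - y) * (cheb y (Suc m) - cheb y m) ^ 2"

definition block_riley :: "nat \<Rightarrow> 'a::comm_ring_1 \<Rightarrow> 'a \<Rightarrow> 'a" where
  "block_riley m x y = 1 + (x^2 - 2 - y) * (cheb y (Suc m) - cheb y m) * cheb y (Suc m)"

lemma word_matrix_Cons: "word_matrix s y (l # w) = letter_matrix s y l ** word_matrix s y w"
  by (simp add: word_matrix_def)

lemma word_matrix_Nil: "word_matrix s y [] = mat 1"
  by (simp add: word_matrix_def)

text \<open>Each of the four two-letter words has determinant 1 and trace \<open>y\<close>, so its
  powers involve Chebyshev polynomials in \<open>y\<close>.\<close>

lemma twist_power:
  fixes s y :: complex and m :: nat
  assumes s: "s \<noteq> 0"
  defines "P \<equiv> cheb y (Suc m)" and "Q \<equiv> cheb y m"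
  shows
   "word_matrix s y (concat (replicate m [(Gen_a, 1), (Gen_b, -1)])) =
      vector [vector [P - Q, Q * s], vector [Q * (y - 2) * inverse s, P - (y - 1) * Q]]" (is ?ab)
   "word_matrix s y (concat (replicate m [(Gen_b, 1), (Gen_a, -1)])) =
      vector [vector [P - (y - 1) * Q, - (Q * s)], vector [Q * (2 - y) * inverse s, P - Q]]" (is ?ba)
   "word_matrix s y (concat (replicate m [(Gen_b, -1), (Gen_a, 1)])) =
      vector [vector [P - (y - 1) * Q, Q * inverse s], vector [Q * (y - 2) * s, P - Q]]" (is ?ba')
   "word_matrix s y (concat (replicate m [(Gen_a, -1), (Gen_b, 1)])) =
      vector [vector [P - Q, - (Q * inverse s)], vector [Q * (2 - y) * s, P - (y - 1) * Q]]" (is ?ab')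
proof -
  note eqs = word_matrix_power [OF s] word_matrix_Cons word_matrix_Nil letter_matrix_eqs [OF s]
    matrix_2_eq_iff mat_def P_def Q_def
  show ?ab ?ba ?ba' ?ab'
    using s by (simp_all add: eqs algebra_simps del: letter_matrix.simps cheb.simps)
qed

lemma block_word_minus_matrix:
  fixes s x y :: complex and m :: nat
  assumes s: "s \<noteq> 0" and x: "x = s + inverse s"
  defines "M \<equiv> word_matrix s y (block_word m Gen_a Gen_b 1)"
  shows "M $ 1 $ 1 + M $ 2 $ 2 = block_trace m x y"
    and "M $ 1 $ 1 + (inverse s - s) * M $ 1 $ 2 = block_riley m x y"
proof -
  define t where "t = inverse s"
  define P where "P = cheb y (Suc m)"
  define Q where "Q = cheb y m"
  \<comment> \<open>With \<open>t\<close> for the inverse of \<open>s\<close>, both claims become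
    polynomial identities modulo this relation and the quadratic relation between \<open>P\<close>
    and \<open>Q\<close>.\<close>
  have t: "s * t = 1"
    using s by (simp add: t_def)
  have PQ: "P ^ 2 - y * P * Q + Q ^ 2 = 1"
    using cheb_quadratic [of y m] by (simp add: P_def Q_def del: cheb.simps)
  note eqs = M_def block_word_def word_matrix_append word_matrix_Cons word_matrix_Nil
    letter_matrix_eqs [OF s] twist_power [OF s] block_trace_def block_riley_def x
    t_def [symmetric] P_def [symmetric] Q_def [symmetric]
  show "M $ 1 $ 1 + M $ 2 $ 2 = block_trace m x y"
    using t PQ by (simp add: eqs mat_def del: letter_matrix.simps cheb.simps) algebra
  show "M $ 1 $ 1 + (inverse s - s) * M $ 1 $ 2 = block_riley m x y"
    using t PQ by (simp add: eqs mat_def del: letter_matrix.simps cheb.simps) algebra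
qed

text \<open>\<open>N\<close> strips the outer letters from one inverse block, so for m > 0 the
  second formula is the case n = 1 of the Riley polynomial of J(2m+1, 2n).\<close>

lemma block_word_plus_matrix:
  fixes s x y :: complex and m :: nat
  assumes s: "s \<noteq> 0" and x: "x = s + inverse s"
  defines "M \<equiv> word_matrix s y (block_word m Gen_b Gen_a (-1))"
  defines "N \<equiv> letter_matrix s y (Gen_b, 1) ** M ** letter_matrix s y (Gen_a, 1)"
  shows "M $ 1 $ 1 + M $ 2 $ 2 = block_trace m x y"
    and "N $ 1 $ 1 + (inverse s - s) * N $ 1 $ 2 = block_trace m x y - block_riley m x y"
proof -
  define t where "t = inverse s"
  define P where "P = cheb y (Suc m)"
  define Q where "Q = cheb y m"
  have t: "s * t = 1"
    using s by (simp add: t_def)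
  have PQ: "P ^ 2 - y * P * Q + Q ^ 2 = 1"
    using cheb_quadratic [of y m] by (simp add: P_def Q_def del: cheb.simps)
  note eqs = M_def N_def block_word_def word_matrix_append word_matrix_Cons word_matrix_Nil
    letter_matrix_eqs [OF s] twist_power [OF s] block_trace_def block_riley_def x
    t_def [symmetric] P_def [symmetric] Q_def [symmetric]
  show "M $ 1 $ 1 + M $ 2 $ 2 = block_trace m x y"
    using t PQ by (simp add: eqs mat_def del: letter_matrix.simps cheb.simps) algebra
  show "N $ 1 $ 1 + (inverse s - s) * N $ 1 $ 2 = block_trace m x y - block_riley m x y"
    using t PQ by (simp add: eqs mat_def del: letter_matrix.simps cheb.simps) algebra
qed

text \<open>\<open>riley_minus\<close> and \<open>riley_plus\<close> belong to \<open>J(2m+1, -2n)\<close> and \<open>J(2m+1, 2n)\<close>.\<close>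

definition riley_minus :: "nat \<Rightarrow> nat \<Rightarrow> 'a::comm_ring_1 \<Rightarrow> 'a \<Rightarrow> 'a" where
  "riley_minus m n x y = (let z = block_trace m x y in
     cheb z (Suc n) + (block_riley m x y - z) * cheb z n)"

definition riley_plus :: "nat \<Rightarrow> nat \<Rightarrow> 'a::comm_ring_1 \<Rightarrow> 'a \<Rightarrow> 'a" where
  "riley_plus m n x y = (let z = block_trace m x y in
     cheb z (Suc n) - block_riley m x y * cheb z n)"

text \<open>The functional X11 + (1/s - s) X12 is linear in X, with value 1 at the identity and R at
  the matrix of v.\<close>

lemma riley_fun_minus:
  fixes s x y :: complex and m n :: nat
  assumes s: "s \<noteq> 0" and x: "x = s + inverse s"
  shows "riley_fun (4 * m * n + 2 * n + 1) (4 * m * n + 1) s y = riley_minus m n x y"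
  unfolding riley_fun_def schubert_word_minus word_matrix_power [OF s] Let_def
    block_word_minus_matrix(1) [OF s x] riley_minus_def block_word_minus_matrix(2) [OF s x, symmetric]
  by (simp add: mat_def algebra_simps del: cheb.simps)

lemma riley_fun_plus:
  fixes s x y :: complex and m n :: nat
  assumes s: "s \<noteq> 0" and x: "x = s + inverse s" and mn: "m > 0" "n > 0"
  shows "riley_fun (4 * m * n + 2 * n - 1) (4 * m * n - 1) s y = riley_plus m n x y"
proof -
  define W where "W = word_matrix s y (schubert_word (4 * m * n + 2 * n - 1) (4 * m * n - 1))"
  define M where "M = word_matrix s y (block_word m Gen_b Gen_a (-1))"
  define K where "K = word_matrix s y (concat (replicate n (block_word m Gen_b Gen_a (-1))))"
  define z where "z = block_trace m x y"
  define \<alpha> where "\<alpha> = cheb z (Suc n) - z * cheb z n"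
  have K: "K = (\<chi> i j. \<alpha> * (mat 1 :: complex^2^2) $ i $ j + cheb z n * M $ i $ j)"
    unfolding K_def word_matrix_power [OF s] block_word_plus_matrix(1) [OF s x] M_def \<alpha>_def z_def ..
  have "K = letter_matrix s y (Gen_b, -1) ** W ** letter_matrix s y (Gen_a, -1)"
    unfolding K_def W_def schubert_word_plus [OF mn, symmetric] by (rule word_matrix_Cons_snoc)
  then have "letter_matrix s y (Gen_b, 1) ** K ** letter_matrix s y (Gen_a, 1) =
      (letter_matrix s y (Gen_b, 1) ** letter_matrix s y (Gen_b, -1)) ** W **
      (letter_matrix s y (Gen_a, -1) ** letter_matrix s y (Gen_a, 1))"
    by (simp only: matrix_mul_assoc)
  also have "letter_matrix s y (Gen_b, 1) ** letter_matrix s y (Gen_b, -1) = mat 1"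
    unfolding letter_matrix_eqs [OF s] using s by (simp add: matrix_2_eq_iff mat_def field_simps)
  also have "letter_matrix s y (Gen_a, -1) ** letter_matrix s y (Gen_a, 1) = mat 1"
    unfolding letter_matrix_eqs [OF s] using s by (simp add: matrix_2_eq_iff mat_def)
  finally have W: "W = letter_matrix s y (Gen_b, 1) ** K ** letter_matrix s y (Gen_a, 1)"
    by simp
  \<comment> \<open>The functional has value 1 on B A, so the identity part of \<open>K\<close>
    contributes \<open>\<alpha>\<close>; the part from \<open>M\<close> contributes z - R.\<close>
  have "W $ 1 $ 1 + (inverse s - s) * W $ 1 $ 2 =
      \<alpha> + cheb z n * (z - block_riley m x y)"
    unfolding W K z_def block_word_plus_matrix(2) [OF s x, symmetric] M_def [symmetric]
      letter_matrix_eqs [OF s]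
    using s by (simp add: mat_def field_simps del: cheb.simps)
  then show ?thesis
    by (simp add: riley_fun_def W_def riley_plus_def \<alpha>_def z_def Let_def algebra_simps
        del: cheb.simps)
qed

section \<open>Values of the Riley polynomials at real arguments\<close>

lemma block_of_real:
  "block_trace m (of_real x) (of_real y :: complex) = of_real (block_trace m x y)"
  "block_riley m (of_real x) (of_real y :: complex) = of_real (block_riley m x y)"
  by (simp_all add: block_trace_def block_riley_def cheb_of_real del: cheb.simps)

text \<open>A parameter \<open>s\<close> with s + 1/s = x may be nonreal, so the closed form is
  applied over the complex numbers and then restricted. Coprimality reduces to that of 2n and 4mn +
  1.\<close>

lemma poly2_riley_minus:
  "poly2 (riley_poly (4 * m * n + 2 * n + 1) (4 * m * n + 1)) (of_real x) (of_real y) =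
     of_real (riley_minus m n x y)"
proof -
  obtain s :: complex where s: "s \<noteq> 0" "s + inverse s = of_real x"
    using ex_add_inverse by blast
  have "coprime (4 * m * n + 1) (n * (4 * m))"
    using coprime_add_one_left [of "n * (4 * m)"] by (simp add: mult_ac)
  then have "coprime (4 * m * n + 1) n"
    by simp
  then have "coprime (4 * m * n + 1) (2 * n)"
    by (simp add: coprime_mult_right_iff)
  then have "coprime (2 * n + (4 * m * n + 1)) (4 * m * n + 1)"
    by (metis coprime_iff_gcd_eq_1 gcd_add1 gcd.commute)
  then have "coprime (4 * m * n + 2 * n + 1) (4 * m * n + 1)"
    by (simp add: add_ac)
  then have "poly2 (riley_poly (4 * m * n + 2 * n + 1) (4 * m * n + 1)) (s + inverse s) (of_real y) =
      riley_fun (4 * m * n + 2 * n + 1) (4 * m * n + 1) s (of_real y)"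
    using s by (intro poly2_riley_poly) auto
  also have "\<dots> = riley_minus m n (of_real x) (of_real y)"
    by (rule riley_fun_minus [OF s(1) s(2) [symmetric]])
  finally show ?thesis
    by (simp add: s riley_minus_def block_of_real cheb_of_real Let_def del: cheb.simps)
qed

lemma poly2_riley_plus:
  assumes "m > 0" "n > 0"
  shows "poly2 (riley_poly (4 * m * n + 2 * n - 1) (4 * m * n - 1)) (of_real x) (of_real y) =
     of_real (riley_plus m n x y)"
proof -
  obtain s :: complex where s: "s \<noteq> 0" "s + inverse s = of_real x"
    using ex_add_inverse by blast
  have mn: "4 * m * n > 0"
    using assms by simp
  define q where "q = 4 * m * n - 1"
  have q: "4 * m * n = Suc q"
    using mn by (simp add: q_def)
  have "coprime q (n * (4 * m))"
    using q coprime_Suc_right_nat [of q] by (simp add: mult_ac)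
  then have "coprime q n"
    by simp
  moreover have "even (Suc q)"
    unfolding q [symmetric] by simp
  ultimately have "coprime q (2 * n)" and odd: "odd q"
    by (simp_all add: coprime_mult_right_iff)
  then have "coprime (2 * n + q) q"
    by (metis coprime_iff_gcd_eq_1 gcd_add1 gcd.commute)
  moreover have p: "4 * m * n + 2 * n - 1 = 2 * n + q"
    using q by simp
  ultimately have "poly2 (riley_poly (4 * m * n + 2 * n - 1) (4 * m * n - 1)) (s + inverse s) (of_real y) =
      riley_fun (4 * m * n + 2 * n - 1) (4 * m * n - 1) s (of_real y)"
    unfolding q_def [symmetric] p using s odd by (intro poly2_riley_poly) auto
  also have "\<dots> = riley_plus m n (of_real x) (of_real y)"
    by (rule riley_fun_plus [OF s(1) s(2) [symmetric] assms])
  finally show ?thesis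
    by (simp add: s riley_plus_def block_of_real cheb_of_real Let_def del: cheb.simps)
qed

section \<open>Counting real roots\<close>

text \<open>The intermediate value theorem gives a root in each gap; it is not an endpoint, so roots
  from different gaps differ.\<close>

lemma alternating_signs_roots:
  fixes f g :: "_ \<Rightarrow> real"
  assumes cont: "continuous_on UNIV f"
    and g: "\<And>j. j < N \<Longrightarrow> g j < g (Suc j)"
    and sgn: "\<And>j. j \<le> N \<Longrightarrow> (-1) ^ j * f (g j) > 0"
  shows "\<exists>S. finite S \<and> card S = N \<and> (\<forall>y\<in>S. f y = 0)"
proof -
  have "\<exists>r. g j < r \<and> r < g (Suc j) \<and> f r = 0" if j: "j < N" for j
  proof -
    have "\<exists>r\<ge>g j. r \<le> g (Suc j) \<and> (-1) ^ j * f r = 0"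
      using sgn [of j] sgn [of "Suc j"] g [OF j] j
      by (intro IVT2' continuous_intros continuous_on_subset [OF cont]) auto
    then obtain r where r: "g j \<le> r" "r \<le> g (Suc j)" "f r = 0"
      by auto
    moreover have "r \<noteq> g j" "r \<noteq> g (Suc j)"
      using r(3) sgn [of j] sgn [of "Suc j"] j by auto
    ultimately show ?thesis
      by (metis order_less_le)
  qed
  then obtain r where r: "\<And>j. j < N \<Longrightarrow> g j < r j \<and> r j < g (Suc j) \<and> f (r j) = 0"
    by metis
  have mono: "g i \<le> g j" if "i \<le> j" "j \<le> N" for i j
    using that
  proof (induction rule: dec_induct)
    case (step k)
    then show ?case using g [of k] by simp
  qed simp
  have "r i < r j" if "i < j" "j < N" for i j
    using r [of i] r [of j] mono [of "Suc i" j] that by simp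
  then have "inj_on r {..<N}"
    by (metis inj_onI lessThan_iff less_irrefl nat_neq_iff)
  then show ?thesis
    using r by (intro exI [of _ "r ` {..<N}"]) (auto simp: card_image)
qed

text \<open>The points are chosen greedily: from the last one, where \<open>f\<close> equals
  \<open>c n\<close>, the function must still come down to the next level before \<open>b\<close>.
  No monotonicity of \<open>f\<close> is assumed.\<close>

lemma successive_crossings:
  fixes f :: "real \<Rightarrow> real" and c :: "nat \<Rightarrow> real"
  assumes "continuous_on {a..b} f" "a \<le> b" "f a = c 0" "f b \<le> c n"
    and "\<And>j. j < n \<Longrightarrow> c (Suc j) < c j"
  shows "\<exists>g. (\<forall>j\<le>n. a \<le> g j \<and> g j \<le> b \<and> f (g j) = c j) \<and> g 0 = a \<and> (\<forall>j<n. g j < g (Suc j))"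
  using assms
proof (induction n)
  case 0
  then show ?case by (intro exI [of _ "\<lambda>_. a"]) auto
next
  case (Suc n)
  have c: "c (Suc n) < c n"
    using Suc.prems by simp
  then have "f b \<le> c n"
    using Suc.prems by linarith
  then obtain g where g: "\<forall>j\<le>n. a \<le> g j \<and> g j \<le> b \<and> f (g j) = c j" "g 0 = a"
      "\<forall>j<n. g j < g (Suc j)"
    using Suc by force
  have "\<exists>r\<ge>g n. r \<le> b \<and> f r = c (Suc n)"
    using g(1) less_imp_le [OF c] Suc.prems
    by (intro IVT2' continuous_on_subset [OF Suc.prems(1)]) auto
  then obtain r where r: "g n \<le> r" "r \<le> b" "f r = c (Suc n)"
    by blast
  then have "g n < r"
    using c g(1) by (metis le_less less_irrefl order_refl)
  with g r show ?case
    by (intro exI [of _ "g(Suc n := r)"]) (auto simp: le_Suc_eq less_Suc_eq)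
qed

lemma continuous_on_cheb [continuous_intros]:
  fixes f :: "real \<Rightarrow> real"
  shows "continuous_on A f \<Longrightarrow> continuous_on A (\<lambda>y. cheb (f y) k)"
  by (induction "0::real" k rule: cheb.induct) (auto intro!: continuous_intros)

lemma continuous_on_block:
  "continuous_on A (\<lambda>y::real. block_trace m x y)" "continuous_on A (\<lambda>y::real. block_riley m x y)"
  unfolding block_trace_def block_riley_def by (intro continuous_intros)+

theorem theorem2:
  fixes m n :: nat and x0 :: real
  assumes "m > 0" and "n > 0"
    and "\<bar>x0\<bar> \<ge> 2 * cos (pi / (4 * real m + 2))"
  shows "(\<exists>S::real set. finite S \<and> card S \<ge> n - 1 \<and>
            (\<forall>y\<in>S. poly2 (riley_poly (4 * m * n + 2 * n - 1) (4 * m * n - 1))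
                      (of_real x0) (of_real y) = 0)) \<and>
         (\<exists>S::real set. finite S \<and> card S \<ge> n \<and>
            (\<forall>y\<in>S. poly2 (riley_poly (4 * m * n + 2 * n + 1) (4 * m * n + 1))
                      (of_real x0) (of_real y) = 0))"
proof -
  define z where "z = block_trace m x0"
  define R where "R = block_riley m x0"
  define c where "c = (\<lambda>j. 2 * cos (real j * pi / real n))"
  \<comment> \<open>At \<open>a\<close> the factor x0^2 - 2 - y is 0; at \<open>b\<close> it is -4,
    and b \<ge> 2 makes the squared Chebyshev difference at least 1.\<close>
  define a where "a = x0 ^ 2 - 2"
  define b where "b = x0 ^ 2 + 2"
  have za: "z a = 2" and Ra: "R a = 1"
    by (simp_all add: z_def R_def a_def block_trace_def block_riley_def)
  have zb: "z b \<le> -2"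
  proof -
    have "cheb b (Suc m) - cheb b m \<ge> 1"
      using cheb_increment_ge_1 [of b m] by (simp add: b_def)
    then have "(cheb b (Suc m) - cheb b m) ^ 2 \<ge> 1"
      by (rule one_le_power)
    then show ?thesis
      by (simp add: z_def block_trace_def b_def del: cheb.simps)
  qed
  have c0: "c 0 = 2" and cn: "c n = -2"
    using \<open>n > 0\<close> by (simp_all add: c_def)
  have c_dec: "c (Suc j) < c j" if "j < n" for j
  proof -
    have "real (Suc j) * pi \<le> real n * pi"
      using that by (intro mult_right_mono) auto
    then have "real (Suc j) * pi / real n \<le> pi"
      using that by (simp add: divide_le_eq mult.commute)
    moreover have "real j * pi / real n < real (Suc j) * pi / real n"
      using that by (intro divide_strict_right_mono mult_strict_right_mono) auto
    ultimately show ?thesis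
      unfolding c_def by (auto intro!: cos_monotone_0_pi)
  qed
  have contz: "continuous_on A z" and contR: "continuous_on A R" for A
    unfolding z_def R_def by (rule continuous_on_block)+
  obtain g where g: "\<And>j. j \<le> n \<Longrightarrow> a \<le> g j \<and> z (g j) = c j" "g 0 = a"
      "\<And>j. j < n \<Longrightarrow> g j < g (Suc j)"
    using successive_crossings [OF contz, of a b c n] za zb c0 cn c_dec
    by (auto simp: a_def b_def)
  have plus: "riley_plus m n x0 = (\<lambda>y. cheb (z y) (Suc n) - R y * cheb (z y) n)"
    and minus: "riley_minus m n x0 = (\<lambda>y. cheb (z y) (Suc n) + (R y - z y) * cheb (z y) n)"
    by (simp_all add: riley_plus_def riley_minus_def z_def R_def Let_def fun_eq_iff)
  have cont: "continuous_on UNIV (riley_plus m n x0)" "continuous_on UNIV (riley_minus m n x0)"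
    unfolding plus minus by (intro continuous_intros contz contR)+
  \<comment> \<open>For 0 < j < n the coefficient \<open>cheb (z y) n\<close> of \<open>R\<close>
    vanishes. At j = 0 both values are (n + 1) - n.\<close>
  have vals: "riley_plus m n x0 (g j) = (-1) ^ j \<and> riley_minus m n x0 (g j) = (-1) ^ j"
    if "j < n" for j
  proof (cases "j = 0")
    case True
    then show ?thesis
      using g(2) by (simp add: plus minus za Ra cheb_2 del: cheb.simps)
  next
    case False
    then show ?thesis
      using cheb_at_root [of j n] g(1) [of j] that by (simp add: plus minus c_def del: cheb.simps)
  qed
  have last: "(-1) ^ n * riley_minus m n x0 (g n) > 0"
  proof -
    define P where "P = cheb (g n) (Suc m)"
    define Q where "Q = cheb (g n) m"
    define u where "u = x0 ^ 2 - 2 - g n"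
    have zn: "z (g n) = -2" and un: "u \<le> 0"
      using g(1) [of n] cn by (simp_all add: u_def a_def)
    \<comment> \<open>The bound on \<open>x0\<close> enters here: squaring and halving the angle
      give x0^2 - 2 \<ge> 4 cos^2 \<beta> - 2 = 2 cos (2 \<beta>), and \<open>g n\<close> is at
      least \<open>a\<close>.\<close>
    have "2 * cos (pi / (2 * real m + 1)) \<le> a"
    proof -
      define \<beta> where "\<beta> = pi / (4 * real m + 2)"
      have "\<beta> \<le> pi / 2"
        unfolding \<beta>_def by (intro divide_left_mono) auto
      then have "cos \<beta> \<ge> 0"
        by (intro cos_ge_zero) (auto simp: \<beta>_def intro: order_trans [of _ 0])
      then have "(2 * cos \<beta>) ^ 2 \<le> \<bar>x0\<bar> ^ 2"
        using assms(3) by (intro power_mono) (auto simp: \<beta>_def)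
      moreover have "pi / (2 * real m + 1) = 2 * \<beta>"
        by (simp add: \<beta>_def field_simps)
      ultimately show ?thesis
        by (simp add: cos_double_cos a_def power_mult_distrib)
    qed
    then have "Q ^ 2 \<le> P ^ 2"
      using g(1) [of n] unfolding P_def Q_def by (intro cheb_square_mono assms) linarith
    then have "u * (P ^ 2 - Q ^ 2) \<le> 0"
      using un by (simp add: mult_nonpos_nonneg)
    moreover have "u * (P - Q) ^ 2 = -4"
      using zn by (simp add: z_def block_trace_def u_def P_def Q_def del: cheb.simps)
    \<comment> \<open>From 2 (P - Q) P = (P - Q)^2 + (P^2 - Q^2); the first term gives -4 and the
      second is at most 0, so R \<le> -1.\<close>
    moreover have "2 * (R (g n) - 1) = u * (P - Q) ^ 2 + u * (P ^ 2 - Q ^ 2)"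
      by (simp add: R_def block_riley_def u_def P_def Q_def power2_eq_square algebra_simps
          del: cheb.simps)
    ultimately have "R (g n) + 1 \<le> 0"
      by simp
    then have "real n * (R (g n) + 1) \<le> 0"
      by (simp add: mult_nonneg_nonpos)
    moreover have "riley_minus m n x0 (g n) = (-1) ^ n * (1 - real n * (R (g n) + 1))"
      unfolding minus zn cheb_minus_2 by (simp add: algebra_simps)
    then have "(-1) ^ n * riley_minus m n x0 (g n) = 1 - real n * (R (g n) + 1)"
      by (simp flip: mult.assoc power_mult_distrib)
    ultimately show ?thesis
      by simp
  qed
  \<comment> \<open>The points up to \<open>g (n - 1)\<close> leave n - 1 gaps; for
    \<open>riley_minus\<close> the sign at \<open>g n\<close> adds one more.\<close>
  have "\<exists>S. finite S \<and> card S = n - 1 \<and> (\<forall>y\<in>S. riley_plus m n x0 y = 0)"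
    using g(3) vals \<open>n > 0\<close> by (intro alternating_signs_roots [OF cont(1), of _ g]) auto
  moreover have "\<exists>S. finite S \<and> card S = n \<and> (\<forall>y\<in>S. riley_minus m n x0 y = 0)"
    using g(3) vals last
    by (intro alternating_signs_roots [OF cont(2), of _ g]) (auto simp: le_less)
  ultimately show ?thesis
    unfolding poly2_riley_plus [OF assms(1,2)] poly2_riley_minus of_real_eq_0_iff
    by (metis order_refl)
qed

end
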